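(* A system $(E,A)$ of linear maps between finite-dimensional complex vector spaces is a regular pencil if and only if all its defects $\beta^+_k$ and $\beta^-_k$ ($k\ge 1$) are zero.
   Context: A system $(E,A)$ is a pair of $\mathbb C$-linear maps $E,A:M\to V$ with the same finite-dimensional domain $M$ and the same finite-dimensional codomain $V$. It is a regular pencil if there exists $\lambda\in\mathbb C$ such that $\lambda E+A$ is invertible. Reduction: put $V'=EM$ and $M'=A^{-1}V'=\{x\in M: Ax\in V'\}$. Then $E$ and $A$ map $M'$ into $V'$; let $E',A':M'\to V'$ be the restrictions. The reduced system is $(E,A)'=(E',A')$. Define $(E^{(0)},A^{(0)})=(E,A)$ and $(E^{(k+1)},A^{(k+1)})=(E^{(k)},A^{(k)})'$. The index $n$ of $(E,A)$ is the smallest integer $n\ge 0$ with $(E^{(n+1)},A^{(n+1)})=(E^{(n)},A^{(n)})$ (it always exists), and $(E^{(\infty)},A^{(\infty)}):=(E^{(n)},A^{(n)})$. Defects: let $[A]:M/M'\to V/V'$ be the map induced by $A$ on the quotients. Put $\beta_1^+(E,A)=\dim\operatorname{coker}[A]$ and, for $k\ge1$, $\beta^+_k(E,A)=\beta^+_1(E^{(k-1)},A^{(k-1)})$. The dual system of a system $(E,A)$ is the pair of adjoint (transpose) maps $(E^*,A^* )$, $E^*,A^*:V^*\to M^*$. Write $(E^{(\infty)*},A^{(\infty)*})$ for the dual of $(E^{(\infty)},A^{(\infty)})$. For $k\ge1$, $\beta^-_k(E,A):=\beta^+_k(E^{(\infty)*},A^{(\infty)*})$. *)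

theory Defs
  imports "HOL-Algebra.AbelCoset" "Jordan_Normal_Form.VS_Connect"
begin

abbreviation complex_field :: "complex ring" where
  "complex_field \<equiv> class_ring"

abbreviation cdim :: "(complex, 'a) module \<Rightarrow> nat" where
  "cdim V \<equiv> vectorspace.dim complex_field V"

text \<open>
  Only the values of \<open>Emap\<close> and \<open>Amap\<close> on the carrier of \<open>dom_space\<close> are meaningful.
\<close>

record ('m, 'v) pencil_system =
  dom_space :: "(complex, 'm) module"
  cod_space :: "(complex, 'v) module"
  Emap :: "'m \<Rightarrow> 'v"
  Amap :: "'m \<Rightarrow> 'v"

locale fin_dim_system =
  fixes S :: "('m, 'v) pencil_system"
  assumes E_linear: "linear_map complex_field (dom_space S) (cod_space S) (Emap S)"
    and A_linear: "linear_map complex_field (dom_space S) (cod_space S) (Amap S)"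
    and fin_dim_dom: "vectorspace.fin_dim complex_field (dom_space S)"
    and fin_dim_cod: "vectorspace.fin_dim complex_field (cod_space S)"

definition regular_pencil :: "('m, 'v) pencil_system \<Rightarrow> bool" where
  "regular_pencil S \<longleftrightarrow>
    (\<exists>l :: complex.
      bij_betw (\<lambda>x. (l \<odot>\<^bsub>cod_space S\<^esub> Emap S x) \<oplus>\<^bsub>cod_space S\<^esub> Amap S x)
        (carrier (dom_space S)) (carrier (cod_space S)))"


subsection \<open>Reduction\<close>

definition reduced_cod :: "('m, 'v) pencil_system \<Rightarrow> 'v set" where
  "reduced_cod S = Emap S ` carrier (dom_space S)"

definition reduced_dom :: "('m, 'v) pencil_system \<Rightarrow> 'm set" where
  "reduced_dom S = {x \<in> carrier (dom_space S). Amap S x \<in> reduced_cod S}"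

text \<open>
  Restriction only shrinks the carriers; the HOL functions \<open>Emap\<close> and \<open>Amap\<close> are left untouched.
  Hence two iterated reductions of the same system are equal as records iff they have the same
  domain and codomain, that is, iff they are equal as pairs of linear maps.
\<close>

definition reduce :: "('m, 'v) pencil_system \<Rightarrow> ('m, 'v) pencil_system" where
  "reduce S = S\<lparr>dom_space := (dom_space S)\<lparr>carrier := reduced_dom S\<rparr>,
                cod_space := (cod_space S)\<lparr>carrier := reduced_cod S\<rparr>\<rparr>"

definition iter_reduce :: "nat \<Rightarrow> ('m, 'v) pencil_system \<Rightarrow> ('m, 'v) pencil_system" where
  "iter_reduce k S = (reduce ^^ k) S"

definition system_index :: "('m, 'v) pencil_system \<Rightarrow> nat" where
  "system_index S = (LEAST n. iter_reduce (Suc n) S = iter_reduce n S)"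

definition reduce_limit :: "('m, 'v) pencil_system \<Rightarrow> ('m, 'v) pencil_system" where
  "reduce_limit S = iter_reduce (system_index S) S"


subsection \<open>Quotients and defects\<close>

text \<open>
  The elements of \<open>V / W\<close> are the cosets of \<open>W\<close> in \<open>V\<close>.  The fields \<open>mult\<close> and \<open>one\<close>, which a module
  record inherits from ring records, play no role in a vector space.
\<close>

definition quotient_space :: "(complex, 'a) module \<Rightarrow> 'a set \<Rightarrow> (complex, 'a set) module" where
  "quotient_space V W =
    \<lparr>carrier = a_rcosets\<^bsub>V\<^esub> W, mult = undefined, one = undefined,
     zero = W, add = (\<lambda>X Y. X <+>\<^bsub>V\<^esub> Y),
     smult = (\<lambda>c X. ((\<lambda>x. c \<odot>\<^bsub>V\<^esub> x) ` X) <+>\<^bsub>V\<^esub> W)\<rparr>"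

definition coker_space ::
  "(complex, 'a) module \<Rightarrow> (complex, 'b) module \<Rightarrow> ('a \<Rightarrow> 'b) \<Rightarrow> (complex, 'b set) module" where
  "coker_space M V f = quotient_space V (f ` carrier M)"

text \<open>
  The induced map sends the coset \<open>M' + x\<close> to the coset \<open>V' + A x\<close>; the latter is the set of all
  sums of an element of \<open>A (M' + x)\<close> and an element of \<open>V'\<close>, because \<open>A\<close> maps \<open>M'\<close> into \<open>V'\<close>.
\<close>

definition induced_A :: "('m, 'v) pencil_system \<Rightarrow> 'm set \<Rightarrow> 'v set" where
  "induced_A S X = (Amap S ` X) <+>\<^bsub>cod_space S\<^esub> reduced_cod S"

definition beta_plus_one :: "('m, 'v) pencil_system \<Rightarrow> nat" where
  "beta_plus_one S =
    cdim (coker_space (quotient_space (dom_space S) (reduced_dom S))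
                      (quotient_space (cod_space S) (reduced_cod S))
                      (induced_A S))"

text \<open>The defects are meaningful for indices \<open>k \<ge> 1\<close> only.\<close>

definition beta_plus :: "nat \<Rightarrow> ('m, 'v) pencil_system \<Rightarrow> nat" where
  "beta_plus k S = beta_plus_one (iter_reduce (k - 1) S)"


subsection \<open>Duality\<close>

text \<open>
  Linear functionals on \<open>V\<close> are represented by functions that are \<open>undefined\<close> off the carrier,
  so that each functional has exactly one representative; the operations are the pointwise ones
  of \<open>func_space\<close>.
\<close>

definition dual_space :: "(complex, 'a) module \<Rightarrow> (complex, 'a \<Rightarrow> complex) module" where
  "dual_space V = (LinearCombinations.ring.func_space complex_field (carrier V))
    \<lparr>carrier := {f \<in> extensional (carrier V).
       (\<forall>v\<in>carrier V. \<forall>w\<in>carrier V. f (v \<oplus>\<^bsub>V\<^esub> w) = f v + f w) \<and>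
       (\<forall>c. \<forall>v\<in>carrier V. f (c \<odot>\<^bsub>V\<^esub> v) = c * f v)}\<rparr>"

definition transpose_map ::
  "(complex, 'a) module \<Rightarrow> ('a \<Rightarrow> 'b) \<Rightarrow> ('b \<Rightarrow> complex) \<Rightarrow> ('a \<Rightarrow> complex)" where
  "transpose_map M f g = restrict (g \<circ> f) (carrier M)"

definition dual_system ::
  "('m, 'v) pencil_system \<Rightarrow> ('v \<Rightarrow> complex, 'm \<Rightarrow> complex) pencil_system" where
  "dual_system S =
    \<lparr>dom_space = dual_space (cod_space S), cod_space = dual_space (dom_space S),
     Emap = transpose_map (dom_space S) (Emap S),
     Amap = transpose_map (dom_space S) (Amap S)\<rparr>"

definition beta_minus :: "nat \<Rightarrow> ('m, 'v) pencil_system \<Rightarrow> nat" where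
  "beta_minus k S = beta_plus k (dual_system (reduce_limit S))"

end

theory Submission
  imports Defs
begin

text \<open>
  The vanishing of \<open>\<beta>\<^sub>1\<^sup>+\<close> says that \<open>V = EM + AM\<close>. Under this condition \<open>\<lambda>E + A\<close> is bijective on a
  system iff it is bijective on the reduced one: \<open>(\<lambda>E + A)x \<in> V'\<close> iff \<open>x \<in> M'\<close>, and
  \<open>Ex + Ay = E(x - \<lambda>y) + (\<lambda>E + A)y\<close> with \<open>E(x - \<lambda>y) \<in> V'\<close>. Conversely bijectivity of \<open>\<lambda>E + A\<close>
  forces \<open>V = EM + AM\<close>. Hence \<open>\<lambda>E + A\<close> is bijective iff all \<open>\<beta>\<^sub>k\<^sup>+\<close> vanish and it is bijective on
  the limit system. Bijectivity is also invariant under duality, so applying this twice reduces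
  everything to the limit of the dual of the limit. There \<open>E\<close> is surjective, as in any limit, and
  injective, being a restriction of the transpose of a surjective map; so \<open>\<lambda>E + A\<close> is bijective for
  all but finitely many \<open>\<lambda>\<close>, and no condition besides the vanishing of the defects remains.
\<close>

subsection \<open>Vector spaces and linear maps\<close>

context vectorspace
begin

lemma subspaceI:
  assumes "W \<subseteq> carrier V" "\<zero>\<^bsub>V\<^esub> \<in> W"
    and "\<And>v w. v \<in> W \<Longrightarrow> w \<in> W \<Longrightarrow> v \<oplus>\<^bsub>V\<^esub> w \<in> W"
    and "\<And>c v. c \<in> carrier K \<Longrightarrow> v \<in> W \<Longrightarrow> c \<odot>\<^bsub>V\<^esub> v \<in> W"
  shows "VectorSpace.subspace K W V"
  using assms vectorspace_axioms module_axioms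
  by (auto simp: VectorSpace.subspace_def submodule_def)

text \<open>Independence and span inside \<open>W\<close> agree with those in \<open>V\<close>, so
  \<open>dim\<close> bounds the size of independent subsets of \<open>W\<close>; a maximal one
  exists and is a basis. The bound has to come from \<open>V\<close>, as \<open>W\<close> is not yet
  known to be finite-dimensional.\<close>

lemma subspace_basis_exists:
  assumes sub: "VectorSpace.subspace K W V" and fd: "fin_dim"
  shows "\<exists>B. finite B \<and> vectorspace.basis K (vs W) B \<and> lin_indpt B \<and> B \<subseteq> W \<and> span B = W"
proof -
  interpret W: vectorspace K "vs W" using subspace_is_vs[OF sub] .
  have submod: "submodule K W V" using sub by simp
  then have WV: "W \<subseteq> carrier V" by (simp add: submodule_def)
  have li: "W.lin_indpt A \<longleftrightarrow> lin_indpt A" if "A \<subseteq> W" for A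
    using span_li_not_depend(2)[OF that submod] by simp
  have "\<exists>A. finite A \<and> maximal A (\<lambda>S. S \<subseteq> carrier (vs W) \<and> W.lin_indpt S)"
  proof (rule maximal_exists[where B = "{}" and N = dim])
    fix A assume "A \<subseteq> carrier (vs W) \<and> W.lin_indpt A"
    then show "finite A \<and> card A \<le> dim"
      using li li_le_dim[OF fd, of A] WV by auto
  qed (simp add: W.lin_dep_def)
  then obtain B where B: "finite B" "W.basis B"
    using W.max_li_is_basis by blast
  then have BW: "B \<subseteq> W" "W.lin_indpt B" "W.span B = W" by (auto simp: W.basis_def)
  then show ?thesis
    using B li[OF BW(1)] span_li_not_depend(1)[OF BW(1) submod] by auto
qed

lemma subspace_fin_dim:
  assumes "VectorSpace.subspace K W V" "fin_dim"
  shows "vectorspace.fin_dim K (vs W)"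
proof -
  interpret W: vectorspace K "vs W" using subspace_is_vs[OF assms(1)] .
  show ?thesis
    using subspace_basis_exists[OF assms] by (auto simp: W.fin_dim_def W.basis_def)
qed

lemma dim_subspace_le:
  assumes "VectorSpace.subspace K W V" "fin_dim"
  shows "vectorspace.dim K (vs W) \<le> dim"
proof -
  interpret W: vectorspace K "vs W" using subspace_is_vs[OF assms(1)] .
  obtain B where B: "finite B" "W.basis B" "lin_indpt B" "B \<subseteq> W"
    using subspace_basis_exists[OF assms] by auto
  moreover have "W \<subseteq> carrier V" using assms(1) is_module submodule.subset by blast
  ultimately show ?thesis
    using W.dim_basis[OF B(1,2)] li_le_dim(2)[OF assms(2) _ B(3)] by auto
qed

text \<open>Adding a vector outside \<open>W\<close> to a basis of \<open>W\<close> keeps it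
  independent in \<open>V\<close>.\<close>

lemma dim_subspace_less:
  assumes sub: "VectorSpace.subspace K W V" and fd: "fin_dim" and ne: "W \<noteq> carrier V"
  shows "vectorspace.dim K (vs W) < dim"
proof -
  interpret W: vectorspace K "vs W" using subspace_is_vs[OF sub] .
  obtain B where B: "finite B" "W.basis B" "lin_indpt B" "B \<subseteq> W" "span B = W"
    using subspace_basis_exists[OF sub fd] by auto
  have WV: "W \<subseteq> carrier V" using sub is_module submodule.subset by blast
  then obtain v where v: "v \<in> carrier V" "v \<notin> W" using ne by blast
  have "lin_indpt (B \<union> {v})"
    using lin_dep_iff_in_span[of B v] B v WV by blast
  then have "card (B \<union> {v}) \<le> dim"
    using B(4) WV v(1) by (intro li_le_dim(2)[OF fd]) auto
  moreover have "v \<notin> B" using B v by blast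
  ultimately show ?thesis using W.dim_basis[OF B(1,2)] B(1) by simp
qed

lemma dim_mono_strict:
  assumes "VectorSpace.subspace K W V" "VectorSpace.subspace K U V" "W \<subset> U" "fin_dim"
  shows "vectorspace.dim K (vs W) < vectorspace.dim K (vs U)"
proof -
  interpret U: vectorspace K "vs U" by (rule subspace_is_vs[OF assms(2)])
  have "VectorSpace.subspace K W (vs U)"
    using assms(1,3) by (intro U.subspaceI) (auto simp: VectorSpace.subspace_def submodule_def)
  then show ?thesis
    using U.dim_subspace_less[OF _ subspace_fin_dim[OF assms(2,4)]] assms(3) by auto
qed

lemma dim_eq_0_iff:
  assumes "fin_dim"
  shows "dim = 0 \<longleftrightarrow> carrier V = {\<zero>\<^bsub>V\<^esub>}"
proof
  obtain B where B: "finite B" "basis B" using finite_basis_exists[OF assms] by auto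
  assume "dim = 0"
  then have "B = {}" using dim_basis[OF B] B(1) by simp
  then show "carrier V = {\<zero>\<^bsub>V\<^esub>}" using B(2) span_empty by (simp add: basis_def)
next
  assume c: "carrier V = {\<zero>\<^bsub>V\<^esub>}"
  then have "gen_set {\<zero>\<^bsub>V\<^esub>}"
    using in_own_span[of "{\<zero>\<^bsub>V\<^esub>}"] span_is_subset2[of "{\<zero>\<^bsub>V\<^esub>}"] by blast
  then show "dim = 0" by (rule dim0I)
qed

end

section \<open>Criteria for linearity, composition and inverses\<close>

lemma linear_mapI:
  assumes "vectorspace K V" "vectorspace K W"
    and "\<And>v. v \<in> carrier V \<Longrightarrow> f v \<in> carrier W"
    and "\<And>v w. v \<in> carrier V \<Longrightarrow> w \<in> carrier V \<Longrightarrow> f (v \<oplus>\<^bsub>V\<^esub> w) = f v \<oplus>\<^bsub>W\<^esub> f w"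
    and "\<And>c v. c \<in> carrier K \<Longrightarrow> v \<in> carrier V \<Longrightarrow> f (c \<odot>\<^bsub>V\<^esub> v) = c \<odot>\<^bsub>W\<^esub> f v"
  shows "linear_map K V W f"
  using assms
  by (simp add: linear_map_def mod_hom_def mod_hom_axioms_def LinearCombinations.module_hom_def vectorspace_def)

lemma linear_mapD:
  assumes "linear_map K V W f"
  shows "vectorspace K V" "vectorspace K W"
    and "\<And>v. v \<in> carrier V \<Longrightarrow> f v \<in> carrier W"
    and "\<And>v w. v \<in> carrier V \<Longrightarrow> w \<in> carrier V \<Longrightarrow> f (v \<oplus>\<^bsub>V\<^esub> w) = f v \<oplus>\<^bsub>W\<^esub> f w"
    and "\<And>c v. c \<in> carrier K \<Longrightarrow> v \<in> carrier V \<Longrightarrow> f (c \<odot>\<^bsub>V\<^esub> v) = c \<odot>\<^bsub>W\<^esub> f v"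
  using assms
  by (auto simp: linear_map_def mod_hom_def mod_hom_axioms_def LinearCombinations.module_hom_def)

lemma linear_map_comp:
  assumes f: "linear_map K U V f" and g: "linear_map K V W g"
  shows "linear_map K U W (\<lambda>x. g (f x))"
  by (rule linear_mapI) (simp_all add: linear_mapD[OF f] linear_mapD[OF g])

lemma linear_map_inv_into:
  assumes f: "linear_map K V W f" and bij: "bij_betw f (carrier V) (carrier W)"
  shows "linear_map K W V (inv_into (carrier V) f)"
proof -
  let ?g = "inv_into (carrier V) f"
  interpret vectorspace K V by (rule linear_mapD[OF f])
  have g: "?g w \<in> carrier V" "f (?g w) = w" if "w \<in> carrier W" for w
    using bij that by (auto simp: bij_betw_def inv_into_into f_inv_into_f)
  have eq: "?g w = v" if "v \<in> carrier V" "f v = w" for v w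
    using bij that by (auto simp: bij_betw_def)
  show ?thesis
    by (rule linear_mapI)
      (simp_all add: linear_mapD[OF f] g eq)
qed

text \<open>This is the polynomial \<open>(f + (k - 1)) ... (f + 1) f\<close> applied to
  \<open>x\<close>. The newest factor stands outermost, which makes the kernels visibly increase
  with \<open>k\<close>.\<close>

primrec shift_prod :: "(complex, 'a) module \<Rightarrow> ('a \<Rightarrow> 'a) \<Rightarrow> nat \<Rightarrow> 'a \<Rightarrow> 'a" where
  "shift_prod V f 0 x = x"
| "shift_prod V f (Suc k) x =
    of_nat k \<odot>\<^bsub>V\<^esub> shift_prod V f k x \<oplus>\<^bsub>V\<^esub> f (shift_prod V f k x)"

text \<open>If every \<open>k + f\<close> had an eigenvector \<open>x\<^sub>k\<close> for the eigenvalue 0, then \<open>x\<^sub>k\<close> would lie in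
  the kernel of \<open>(k + f) \<cdots> (1 + f) (0 + f)\<close> but not in that of \<open>(k - 1 + f) \<cdots> (0 + f)\<close>,
  so the dimensions of these kernels would be unbounded.\<close>

lemma exists_shift_kernel_trivial:
  fixes V :: "(complex, 'a) module"
  assumes f: "linear_map complex_field V V f" and fd: "vectorspace.fin_dim complex_field V"
  shows "\<exists>k :: nat. \<forall>x\<in>carrier V. of_nat k \<odot>\<^bsub>V\<^esub> x \<oplus>\<^bsub>V\<^esub> f x = \<zero>\<^bsub>V\<^esub> \<longrightarrow> x = \<zero>\<^bsub>V\<^esub>"
proof (rule ccontr)
  assume "\<not> ?thesis"
  then have ev: "\<exists>x\<in>carrier V. x \<noteq> \<zero>\<^bsub>V\<^esub> \<and> of_nat k \<odot>\<^bsub>V\<^esub> x \<oplus>\<^bsub>V\<^esub> f x = \<zero>\<^bsub>V\<^esub>" for k :: nat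
    by blast
  interpret vectorspace complex_field V by (rule linear_mapD[OF f])
  note smult = smult_closed[simplified] smult_l_distr[simplified] smult_r_distr[simplified]
    smult_assoc1[simplified] smult_one[simplified]
  note f_simps = linear_mapD(3-5)[OF f, simplified]
  let ?P = "shift_prod V f"
  let ?N = "\<lambda>k. {x \<in> carrier V. ?P k x = \<zero>\<^bsub>V\<^esub>}"
  have f_zero: "f \<zero>\<^bsub>V\<^esub> = \<zero>\<^bsub>V\<^esub>"
  proof -
    interpret f: linear_map complex_field V V f by (rule f)
    show ?thesis by (rule f.f0_is_0)
  qed
  have P_closed: "?P k x \<in> carrier V" if "x \<in> carrier V" for k x
    using that by (induction k) (simp_all add: smult f_simps)
  have P_add: "?P k (x \<oplus>\<^bsub>V\<^esub> y) = ?P k x \<oplus>\<^bsub>V\<^esub> ?P k y" if "x \<in> carrier V" "y \<in> carrier V" for k x y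
    using that by (induction k) (simp_all add: smult f_simps P_closed M.a_ac)
  have P_smult: "?P k (c \<odot>\<^bsub>V\<^esub> x) = c \<odot>\<^bsub>V\<^esub> ?P k x" if "x \<in> carrier V" for k c x
    using that by (induction k)
      (simp_all add: smult(1-3,5) f_simps P_closed mult.commute flip: smult(4))
  have P_zero: "?P k \<zero>\<^bsub>V\<^esub> = \<zero>\<^bsub>V\<^esub>" for k
    by (induction k) (simp_all add: f_zero)
  have sub: "VectorSpace.subspace complex_field (?N k) V" for k
    by (rule subspaceI) (auto simp: P_closed P_add P_smult P_zero smult)
  have "?N k \<subset> ?N (Suc k)" for k
  proof -
    obtain x where x: "x \<in> carrier V" "x \<noteq> \<zero>\<^bsub>V\<^esub>" "of_nat k \<odot>\<^bsub>V\<^esub> x \<oplus>\<^bsub>V\<^esub> f x = \<zero>\<^bsub>V\<^esub>"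
      using ev by blast
    have "f x = (- of_nat k) \<odot>\<^bsub>V\<^esub> x"
    proof -
      have "f x = ((- of_nat k + of_nat k) \<odot>\<^bsub>V\<^esub> x) \<oplus>\<^bsub>V\<^esub> f x"
        using x(1) lmult_0 f_simps(1) by simp
      also have "\<dots> = (- of_nat k) \<odot>\<^bsub>V\<^esub> x \<oplus>\<^bsub>V\<^esub> (of_nat k \<odot>\<^bsub>V\<^esub> x \<oplus>\<^bsub>V\<^esub> f x)"
        using x(1) f_simps(1) by (simp only: smult M.a_assoc)
      finally show ?thesis using x(1,3) smult(1) by simp
    qed
    \<comment> \<open>On an eigenvector for \<open>-k\<close>, the factor \<open>i + f\<close> acts
      as the scalar \<open>i - k\<close>.\<close>
    then have P_eq: "?P j x = (\<Prod>i<j. of_nat i - of_nat k) \<odot>\<^bsub>V\<^esub> x" for j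
      using x(1)
      by (induction j)
        (simp_all add: smult(1,3,5) f_simps algebra_simps flip: smult(2,4))
    \<comment> \<open>The product now includes the vanishing factor \<open>i = k\<close>; for
      \<open>i < k\<close>, as in \<open>?P k x\<close>, all factors are nonzero.\<close>
    have "?P (Suc k) x = \<zero>\<^bsub>V\<^esub>"
      unfolding P_eq using x(1) lmult_0 by simp
    moreover have "?P k x \<noteq> \<zero>\<^bsub>V\<^esub>"
    proof
      assume "?P k x = \<zero>\<^bsub>V\<^esub>"
      moreover define c :: complex where "c = (\<Prod>i<k. of_nat i - of_nat k)"
      ultimately have "c \<odot>\<^bsub>V\<^esub> x = \<zero>\<^bsub>V\<^esub>" by (simp add: P_eq)
      moreover have "c \<noteq> 0" by (simp add: c_def)
      then have "x = inverse c \<odot>\<^bsub>V\<^esub> (c \<odot>\<^bsub>V\<^esub> x)"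
        using x(1) by (simp add: smult(5) flip: smult(4))
      ultimately show False using x(2) rmult_0 by simp
    qed
    \<comment> \<open>The inclusion itself holds because the outermost factor fixes zero;
      \<open>x\<close> makes it strict.\<close>
    ultimately show ?thesis
      using x(1) f_zero by auto
  qed
  then have less: "cdim (vs (?N k)) < cdim (vs (?N (Suc k)))" for k
    by (intro dim_mono_strict sub fd)
  have "k \<le> cdim (vs (?N k))" for k
  proof (induction k)
    case (Suc k)
    then show ?case using less[of k] by linarith
  qed simp
  \<comment> \<open>The kernel with index \<open>Suc dim\<close> is too large to be a subspace of
    \<open>V\<close>.\<close>
  then have "Suc dim \<le> dim"
    using dim_subspace_le[OF sub fd] order_trans by blast
  then show False by simp
qed

subsection \<open>Quotient spaces\<close>

context
  fixes V :: "(complex, 'a) module" and W :: "'a set"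
  assumes vs: "vectorspace complex_field V" and sub: "VectorSpace.subspace complex_field W V"
begin

interpretation vectorspace complex_field V by (rule vs)

lemma subspace_memD:
  shows "W \<subseteq> carrier V" "\<zero>\<^bsub>V\<^esub> \<in> W"
    and "\<And>v w. v \<in> W \<Longrightarrow> w \<in> W \<Longrightarrow> v \<oplus>\<^bsub>V\<^esub> w \<in> W"
    and "\<And>c v. v \<in> W \<Longrightarrow> c \<odot>\<^bsub>V\<^esub> v \<in> W"
  using sub by (auto simp: VectorSpace.subspace_def submodule_def)

lemma subspace_a_inv_closed: "v \<in> W \<Longrightarrow> \<ominus>\<^bsub>V\<^esub> v \<in> W"
proof -
  assume v: "v \<in> W"
  then have "\<ominus>\<^bsub>V\<^esub> v = (\<ominus>\<^bsub>complex_field\<^esub> \<one>\<^bsub>complex_field\<^esub>) \<odot>\<^bsub>V\<^esub> v"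
    using subspace_memD(1) by (intro smult_minus_1[symmetric]) blast
  then show "\<ominus>\<^bsub>V\<^esub> v \<in> W" using subspace_memD(4)[OF v] by simp
qed

text \<open>Opens the coset calculus of abelian groups, which supplies the additive structure of the
  quotient.\<close>

lemma subspace_abelian_subgroup: "abelian_subgroup W V"
proof (rule abelian_subgroupI3)
  show "additive_subgroup W V"
    unfolding additive_subgroup_def subgroup_def
    using subspace_memD subspace_a_inv_closed by (auto simp flip: a_inv_def)
qed (rule abelian_group_axioms)

interpretation W: abelian_subgroup W V by (rule subspace_abelian_subgroup)

lemma coset_eq_self_iff:
  assumes "v \<in> carrier V"
  shows "W +>\<^bsub>V\<^esub> v = W \<longleftrightarrow> v \<in> W"
  using a_coset_join1[OF _ assms W.a_subgroup] a_coset_join2[OF assms W.a_subgroup] by blast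

lemma coset_eq_iff:
  assumes "v \<in> carrier V" "w \<in> carrier V"
  shows "W +>\<^bsub>V\<^esub> v = W +>\<^bsub>V\<^esub> w \<longleftrightarrow> v \<ominus>\<^bsub>V\<^esub> w \<in> W"
proof -
  have "v \<ominus>\<^bsub>V\<^esub> w \<in> W \<longleftrightarrow> W +>\<^bsub>V\<^esub> (v \<ominus>\<^bsub>V\<^esub> w) = W"
    using coset_eq_self_iff[OF M.minus_closed[OF assms]] by simp
  also have "\<dots> \<longleftrightarrow> W +>\<^bsub>V\<^esub> v = W +>\<^bsub>V\<^esub> w"
    using a_coset_add_inv1[OF _ assms subspace_memD(1)] a_coset_add_inv2[OF _ assms subspace_memD(1)]
    unfolding a_minus_def by blast
  finally show ?thesis by simp
qed

text \<open>Once the operations are expressed by representatives, the vector space laws descend from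
  \<open>V\<close> to the quotient.\<close>

lemma quotient_space_simps:
  shows "carrier (quotient_space V W) = (\<lambda>v. W +>\<^bsub>V\<^esub> v) ` carrier V"
    and "\<zero>\<^bsub>quotient_space V W\<^esub> = W +>\<^bsub>V\<^esub> \<zero>\<^bsub>V\<^esub>"
    and "\<lbrakk>v \<in> carrier V; w \<in> carrier V\<rbrakk> \<Longrightarrow>
      (W +>\<^bsub>V\<^esub> v) \<oplus>\<^bsub>quotient_space V W\<^esub> (W +>\<^bsub>V\<^esub> w) = W +>\<^bsub>V\<^esub> (v \<oplus>\<^bsub>V\<^esub> w)"
    and "v \<in> carrier V \<Longrightarrow> c \<odot>\<^bsub>quotient_space V W\<^esub> (W +>\<^bsub>V\<^esub> v) = W +>\<^bsub>V\<^esub> (c \<odot>\<^bsub>V\<^esub> v)"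
proof -
  show "carrier (quotient_space V W) = (\<lambda>v. W +>\<^bsub>V\<^esub> v) ` carrier V"
    by (auto simp: quotient_space_def A_RCOSETS_def')
  show "\<zero>\<^bsub>quotient_space V W\<^esub> = W +>\<^bsub>V\<^esub> \<zero>\<^bsub>V\<^esub>"
    using subspace_memD(1) by (simp add: quotient_space_def)
  show "(W +>\<^bsub>V\<^esub> v) \<oplus>\<^bsub>quotient_space V W\<^esub> (W +>\<^bsub>V\<^esub> w) = W +>\<^bsub>V\<^esub> (v \<oplus>\<^bsub>V\<^esub> w)"
    if "v \<in> carrier V" "w \<in> carrier V"
    using W.a_rcos_sum[OF that] by (simp add: quotient_space_def)
  assume v: "v \<in> carrier V"
  have W: "w \<in> carrier V" if "w \<in> W" for w using that subspace_memD(1) by blast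
  \<comment> \<open>The summand \<open>W\<close> matters for \<open>c = 0\<close>, where scaling
    collapses the coset to \<open>{0}\<close>; for other \<open>c\<close> it changes
    nothing.\<close>
  have "((\<odot>\<^bsub>V\<^esub>) c ` (W +>\<^bsub>V\<^esub> v)) <+>\<^bsub>V\<^esub> W = W +>\<^bsub>V\<^esub> (c \<odot>\<^bsub>V\<^esub> v)" (is "?L = ?R")
  proof
    show "?L \<subseteq> ?R"
    proof
      fix x assume "x \<in> ?L"
      then obtain a b where ab: "a \<in> W" "b \<in> W" "x = c \<odot>\<^bsub>V\<^esub> (a \<oplus>\<^bsub>V\<^esub> v) \<oplus>\<^bsub>V\<^esub> b"
        by (auto simp: set_add_def' a_r_coset_def')
      then have "x = (c \<odot>\<^bsub>V\<^esub> a \<oplus>\<^bsub>V\<^esub> b) \<oplus>\<^bsub>V\<^esub> c \<odot>\<^bsub>V\<^esub> v"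
        using v W by (simp add: smult_r_distr M.a_ac)
      then show "x \<in> ?R"
        using ab subspace_memD(3,4) by (auto simp: a_r_coset_def')
    qed
    show "?R \<subseteq> ?L"
    proof
      fix x assume "x \<in> ?R"
      then obtain a where a: "a \<in> W" "x = a \<oplus>\<^bsub>V\<^esub> c \<odot>\<^bsub>V\<^esub> v" by (auto simp: a_r_coset_def')
      \<comment> \<open>Leaving \<open>a\<close> to the outer summand avoids dividing by
        \<open>c\<close>, so \<open>c = 0\<close> is covered as well.\<close>
      then have "x = c \<odot>\<^bsub>V\<^esub> (\<zero>\<^bsub>V\<^esub> \<oplus>\<^bsub>V\<^esub> v) \<oplus>\<^bsub>V\<^esub> a"
        using v W by (simp add: M.a_comm)
      then show "x \<in> ?L"
        using a subspace_memD(2) by (auto simp: set_add_def' a_r_coset_def')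
    qed
  qed
  then show "c \<odot>\<^bsub>quotient_space V W\<^esub> (W +>\<^bsub>V\<^esub> v) = W +>\<^bsub>V\<^esub> (c \<odot>\<^bsub>V\<^esub> v)"
    by (simp add: quotient_space_def)
qed

lemma quotient_space_vectorspace: "vectorspace complex_field (quotient_space V W)"
proof (rule vs_criteria)
  show "field complex_field" by (rule class_field)
  have "\<exists>u\<in>carrier V. (W +>\<^bsub>V\<^esub> v) \<oplus>\<^bsub>quotient_space V W\<^esub> (W +>\<^bsub>V\<^esub> u) = \<zero>\<^bsub>quotient_space V W\<^esub>"
    if "v \<in> carrier V" for v
    using that by (intro bexI[of _ "\<ominus>\<^bsub>V\<^esub> v"]) (simp_all add: quotient_space_simps M.r_neg)
  then show "\<forall>v\<in>carrier (quotient_space V W). \<exists>u\<in>carrier (quotient_space V W).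
      v \<oplus>\<^bsub>quotient_space V W\<^esub> u = \<zero>\<^bsub>quotient_space V W\<^esub>"
    by (auto simp: quotient_space_simps(1))
qed (auto simp: quotient_space_simps M.a_ac smult_r_distr smult_l_distr[simplified]
    smult_assoc1[simplified] smult_one[simplified])

lemma coset_linear_map: "linear_map complex_field V (quotient_space V W) (\<lambda>v. W +>\<^bsub>V\<^esub> v)"
  by (rule linear_mapI) (auto simp: vs quotient_space_vectorspace quotient_space_simps)

text \<open>The quotient is the image of \<open>V\<close> under the linear coset map.\<close>

lemma quotient_space_fin_dim:
  assumes "fin_dim"
  shows "vectorspace.fin_dim complex_field (quotient_space V W)"
  by (rule linear_map.rank_nullity_main(2)[OF coset_linear_map assms])
    (simp add: quotient_space_simps(1))

lemma dim_quotient_space_eq_0_iff: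
  assumes "fin_dim"
  shows "cdim (quotient_space V W) = 0 \<longleftrightarrow> W = carrier V"
proof -
  interpret Q: vectorspace complex_field "quotient_space V W" by (rule quotient_space_vectorspace)
  have "cdim (quotient_space V W) = 0 \<longleftrightarrow> (\<lambda>v. W +>\<^bsub>V\<^esub> v) ` carrier V = {W}"
    using Q.dim_eq_0_iff[OF quotient_space_fin_dim[OF assms]]
    by (simp add: quotient_space_simps(1)) (simp add: quotient_space_def)
  also have "\<dots> \<longleftrightarrow> (\<forall>v\<in>carrier V. W +>\<^bsub>V\<^esub> v = W)"
    using M.zero_closed by blast
  also have "\<dots> \<longleftrightarrow> (\<forall>v\<in>carrier V. v \<in> W)"
    by (intro ball_cong refl coset_eq_self_iff)
  also have "\<dots> \<longleftrightarrow> W = carrier V"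
    using subspace_memD(1) by auto
  finally show ?thesis .
qed

end

text \<open>Translates the vanishing of a defect, a statement about dimensions, into surjectivity of
  the induced map.\<close>

lemma dim_coker_space_eq_0_iff:
  assumes lin: "linear_map complex_field M V f" and fd: "vectorspace.fin_dim complex_field V"
  shows "cdim (coker_space M V f) = 0 \<longleftrightarrow> f ` carrier M = carrier V"
proof -
  interpret f: linear_map complex_field M V f by (rule lin)
  show ?thesis
    using dim_quotient_space_eq_0_iff[OF f.W.vectorspace_axioms f.imT_is_subspace fd]
    by (simp add: coker_space_def f.im_def)
qed

subsection \<open>Dual spaces and transposes\<close>

lemma ring_complex_field: "ring complex_field"
  by (rule class_ring.ring_axioms)

lemmas func_space_complex = LinearCombinations.ring.func_space_def[OF ring_complex_field, simplified]

lemma dual_space_simps: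
  "g \<in> carrier (dual_space V) \<longleftrightarrow> g \<in> extensional (carrier V) \<and>
    (\<forall>v\<in>carrier V. \<forall>w\<in>carrier V. g (v \<oplus>\<^bsub>V\<^esub> w) = g v + g w) \<and>
    (\<forall>c. \<forall>v\<in>carrier V. g (c \<odot>\<^bsub>V\<^esub> v) = c * g v)"
  "\<zero>\<^bsub>dual_space V\<^esub> = restrict (\<lambda>v. 0) (carrier V)"
  "g \<oplus>\<^bsub>dual_space V\<^esub> h = restrict (\<lambda>v. g v + h v) (carrier V)"
  "c \<odot>\<^bsub>dual_space V\<^esub> g = restrict (\<lambda>v. c * g v) (carrier V)"
  by (simp_all add: dual_space_def func_space_complex)

context
  fixes V :: "(complex, 'a) module"
  assumes vs: "vectorspace complex_field V"
begin

interpretation vectorspace complex_field V by (rule vs)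

text \<open>The dual is a subspace of the space of all functions on the carrier, so only closure has
  to be checked.\<close>

lemma dual_space_vectorspace: "vectorspace complex_field (dual_space V)"
proof -
  interpret F: vectorspace complex_field "LinearCombinations.ring.func_space complex_field (carrier V)"
    by (rule func_space_is_vs)
  show ?thesis
    unfolding dual_space_def
    by (rule F.subspace_is_vs, rule F.subspaceI)
      (auto simp: func_space_complex extensional_def algebra_simps smult_closed[simplified])
qed

lemma functional_zero:
  assumes "g \<in> carrier (dual_space V)"
  shows "g \<zero>\<^bsub>V\<^esub> = 0"
proof -
  have "g (0 \<odot>\<^bsub>V\<^esub> \<zero>\<^bsub>V\<^esub>) = 0 * g \<zero>\<^bsub>V\<^esub>"
    using assms by (simp only: dual_space_simps M.zero_closed)
  then show ?thesis by (simp add: rmult_0[simplified])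
qed

lemma functional_lincomb:
  assumes g: "g \<in> carrier (dual_space V)" and "finite B" "B \<subseteq> carrier V"
  shows "g (lincomb a B) = (\<Sum>b\<in>B. a b * g b)"
  using assms(2,3)
proof (induction B)
  case empty
  show ?case using functional_zero[OF g] by simp
next
  case (insert b B)
  then have "lincomb a (insert b B) = a b \<odot>\<^bsub>V\<^esub> b \<oplus>\<^bsub>V\<^esub> lincomb a B"
    by (intro lincomb_insert2) auto
  moreover have "lincomb a B \<in> carrier V" "a b \<odot>\<^bsub>V\<^esub> b \<in> carrier V"
    using insert.prems by auto
  ultimately show ?case
    using g insert by (simp add: dual_space_simps)
qed

text \<open>Forming linear combinations over a basis \<open>B\<close> is a linear bijection from
  coefficient functions to \<open>V\<close>, and \<open>\<phi>\<close> is its inverse. Coefficients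
  are taken in \<open>B \<rightarrow>\<^sub>E UNIV\<close> because values off \<open>B\<close> would
  spoil uniqueness.\<close>

lemma coordinates_exist:
  assumes "fin_dim"
  obtains B \<phi> where "finite B" "B \<subseteq> carrier V"
    "linear_map complex_field V (LinearCombinations.ring.func_space complex_field B) \<phi>"
    "\<And>v. v \<in> carrier V \<Longrightarrow> lincomb (\<phi> v) B = v"
    "\<And>a. a \<in> B \<rightarrow>\<^sub>E UNIV \<Longrightarrow> \<phi> (lincomb a B) = a"
proof -
  obtain B where B: "finite B" "basis B" using finite_basis_exists[OF assms] by blast
  then have BV: "B \<subseteq> carrier V" by (simp add: basis_def)
  let ?F = "LinearCombinations.ring.func_space complex_field B"
  let ?L = "\<lambda>a. lincomb a B"
  have F: "carrier ?F = B \<rightarrow>\<^sub>E UNIV" by (simp add: func_space_complex)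
  have ex1: "\<exists>!a. a \<in> B \<rightarrow>\<^sub>E UNIV \<and> lincomb a B = v" if "v \<in> carrier V" for v
    using basis_criterion[OF B(1) BV] B(2) that by simp
  have closed: "?L a \<in> carrier V" for a
    using BV by (intro lincomb_closed) auto
  have bij: "bij_betw ?L (carrier ?F) (carrier V)"
    unfolding bij_betw_def F
  proof
    show "inj_on ?L (B \<rightarrow>\<^sub>E UNIV)"
    proof (rule inj_onI)
      fix a b assume "a \<in> B \<rightarrow>\<^sub>E UNIV" "b \<in> B \<rightarrow>\<^sub>E UNIV" "?L a = ?L b"
      then show "a = b" using ex1[OF closed[of b]] by blast
    qed
    have "v \<in> ?L ` (B \<rightarrow>\<^sub>E UNIV)" if "v \<in> carrier V" for v
      using ex1[OF that] by blast
    then show "?L ` (B \<rightarrow>\<^sub>E UNIV) = carrier V" using closed by blast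
  qed
  show thesis
  proof (rule that)
    show "linear_map complex_field V ?F (inv_into (carrier ?F) ?L)"
      by (rule linear_map_inv_into[OF lincomb_is_linear[OF B(1) BV] bij])
    show "?L (inv_into (carrier ?F) ?L v) = v" if "v \<in> carrier V" for v
      using bij that f_inv_into_f[of v ?L "carrier ?F"] by (simp add: bij_betw_def)
    show "inv_into (carrier ?F) ?L (?L a) = a" if "a \<in> B \<rightarrow>\<^sub>E UNIV" for a
      using bij that inv_into_f_f[of ?L "carrier ?F" a] by (simp add: bij_betw_def F)
  qed (use B BV in auto)
qed

text \<open>The bilinear form that pairs coordinates over a basis maps \<open>V\<close> linearly
  onto its dual, so finite dimension carries over.\<close>

lemma dual_space_fin_dim:
  assumes "fin_dim"
  shows "vectorspace.fin_dim complex_field (dual_space V)"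
proof -
  obtain B \<phi> where B: "finite B" "B \<subseteq> carrier V"
    and lin: "linear_map complex_field V (LinearCombinations.ring.func_space complex_field B) \<phi>"
    and \<phi>: "\<And>v. v \<in> carrier V \<Longrightarrow> lincomb (\<phi> v) B = v"
      "\<And>a. a \<in> B \<rightarrow>\<^sub>E UNIV \<Longrightarrow> \<phi> (lincomb a B) = a"
    using coordinates_exist[OF assms] by blast
  have coord: "\<phi> (v \<oplus>\<^bsub>V\<^esub> w) b = \<phi> v b + \<phi> w b" "\<phi> (c \<odot>\<^bsub>V\<^esub> v) b = c * \<phi> v b"
    if "v \<in> carrier V" "w \<in> carrier V" "b \<in> B" for v w b c
    using linear_mapD(4,5)[OF lin, simplified] that by (simp_all add: func_space_complex)
  have closed: "c \<odot>\<^bsub>V\<^esub> v \<in> carrier V" if "v \<in> carrier V" for c v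
    using that by (simp add: smult_closed)
  let ?D = "\<lambda>w. restrict (\<lambda>v. \<Sum>b\<in>B. \<phi> w b * \<phi> v b) (carrier V)"
  have D_dual: "?D w \<in> carrier (dual_space V)" if "w \<in> carrier V" for w
    by (simp add: dual_space_simps coord closed sum.distrib sum_distrib_left algebra_simps)
  have D_lin: "linear_map complex_field V (dual_space V) ?D"
    by (rule linear_mapI)
      (auto simp: vs dual_space_vectorspace D_dual, 
       auto simp: dual_space_simps coord closed sum.distrib sum_distrib_left algebra_simps
        intro!: restrict_ext)
  have D_surj: "?D ` carrier V = carrier (dual_space V)"
  proof
    show "?D ` carrier V \<subseteq> carrier (dual_space V)" using D_dual by blast
    show "carrier (dual_space V) \<subseteq> ?D ` carrier V"
    proof
      fix g assume g: "g \<in> carrier (dual_space V)"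
      \<comment> \<open>The vector representing \<open>g\<close> has the values of \<open>g\<close>
        on the basis as its coordinates.\<close>
      let ?w = "lincomb (restrict g B) B"
      have "g v = (\<Sum>b\<in>B. \<phi> ?w b * \<phi> v b)" if "v \<in> carrier V" for v
      proof -
        have "g v = g (lincomb (\<phi> v) B)" using \<phi>(1)[OF that] by simp
        also have "\<dots> = (\<Sum>b\<in>B. \<phi> v b * g b)" by (rule functional_lincomb[OF g B])
        also have "\<dots> = (\<Sum>b\<in>B. \<phi> ?w b * \<phi> v b)"
          by (intro sum.cong refl) (simp add: \<phi>(2) mult.commute)
        finally show ?thesis .
      qed
      then have "g = ?D ?w"
        using g by (intro extensionalityI[of _ "carrier V"]) (simp_all add: dual_space_simps)
      moreover have "?w \<in> carrier V" using B by (intro lincomb_closed) auto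
      ultimately show "g \<in> ?D ` carrier V" by blast
    qed
  qed
  show ?thesis by (rule linear_map.rank_nullity_main(2)[OF D_lin assms D_surj])
qed

text \<open>A nonzero vector has a nonzero coordinate, and taking that coordinate is a
  functional.\<close>

lemma functional_nonzero_exists:
  assumes "fin_dim" and v: "v \<in> carrier V" "v \<noteq> \<zero>\<^bsub>V\<^esub>"
  shows "\<exists>g\<in>carrier (dual_space V). g v \<noteq> 0"
proof -
  obtain B \<phi> where B: "finite B" "B \<subseteq> carrier V"
    and lin: "linear_map complex_field V (LinearCombinations.ring.func_space complex_field B) \<phi>"
    and \<phi>: "\<And>v. v \<in> carrier V \<Longrightarrow> lincomb (\<phi> v) B = v"
    using coordinates_exist[OF assms(1)] by metis
  have closed: "c \<odot>\<^bsub>V\<^esub> v \<in> carrier V" if "v \<in> carrier V" for c v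
    using that by (simp add: smult_closed)
  have "\<exists>b\<in>B. \<phi> v b \<noteq> 0"
  proof (rule ccontr)
    assume "\<not> ?thesis"
    then have "lincomb (\<phi> v) B = \<zero>\<^bsub>V\<^esub>"
      using B(2) unfolding lincomb_def by (intro M.finsum_all0) (auto simp: lmult_0[simplified])
    then show False using \<phi>[OF v(1)] v(2) by simp
  qed
  then obtain b where b: "b \<in> B" "\<phi> v b \<noteq> 0" by blast
  have "restrict (\<lambda>w. \<phi> w b) (carrier V) \<in> carrier (dual_space V)"
    using linear_mapD(4,5)[OF lin, simplified] b(1)
    by (simp add: dual_space_simps closed func_space_complex)
  then show ?thesis using b(2) v(1) by (intro bexI) auto
qed

end

section \<open>Transposes and their injectivity and surjectivity\<close>

context
  fixes V :: "(complex, 'a) module" and W :: "(complex, 'b) module" and f :: "'a \<Rightarrow> 'b"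
  assumes f: "linear_map complex_field V W f"
begin

interpretation V: vectorspace complex_field V by (rule linear_mapD[OF f])
interpretation W: vectorspace complex_field W by (rule linear_mapD[OF f])

lemma transpose_map_closed:
  "g \<in> carrier (dual_space W) \<Longrightarrow> transpose_map V f g \<in> carrier (dual_space V)"
  by (simp add: dual_space_simps transpose_map_def linear_mapD(3-5)[OF f, simplified]
      V.smult_closed[simplified])

lemma transpose_map_linear:
  "linear_map complex_field (dual_space W) (dual_space V) (transpose_map V f)"
  by (rule linear_mapI)
    (auto simp: dual_space_vectorspace V.vectorspace_axioms W.vectorspace_axioms
      transpose_map_closed,
     auto simp: dual_space_simps transpose_map_def linear_mapD(3)[OF f] intro!: restrict_ext)

lemma transpose_map_inj:
  assumes "f ` carrier V = carrier W"
  shows "inj_on (transpose_map V f) (carrier (dual_space W))"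
proof (rule inj_onI)
  fix g h assume gh: "g \<in> carrier (dual_space W)" "h \<in> carrier (dual_space W)"
    and eq: "transpose_map V f g = transpose_map V f h"
  show "g = h"
  proof (rule extensionalityI)
    fix w assume "w \<in> carrier W"
    then obtain v where "v \<in> carrier V" "w = f v" using assms by blast
    then show "g w = h w" using fun_cong[OF eq, of v] by (simp add: transpose_map_def)
  qed (use gh in \<open>simp_all add: dual_space_simps\<close>)
qed

lemma transpose_map_surj:
  assumes bij: "bij_betw f (carrier V) (carrier W)"
  shows "transpose_map V f ` carrier (dual_space W) = carrier (dual_space V)"
proof
  show "transpose_map V f ` carrier (dual_space W) \<subseteq> carrier (dual_space V)"
    using transpose_map_closed by blast
  show "carrier (dual_space V) \<subseteq> transpose_map V f ` carrier (dual_space W)"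
  proof
    fix g assume g: "g \<in> carrier (dual_space V)"
    \<comment> \<open>The preimage of \<open>g\<close> is its pullback along the inverse of
      \<open>f\<close>.\<close>
    let ?h = "transpose_map W (inv_into (carrier V) f) g"
    note inv = linear_map_inv_into[OF f bij]
    have "?h \<in> carrier (dual_space W)"
      using g linear_mapD(3-5)[OF inv, simplified] W.smult_closed[simplified]
      by (simp add: dual_space_simps transpose_map_def)
    moreover have "g = transpose_map V f ?h"
      using g bij linear_mapD(3)[OF f]
      by (intro extensionalityI[of _ "carrier V"])
        (auto simp: dual_space_simps transpose_map_def bij_betw_def)
    ultimately show "g \<in> transpose_map V f ` carrier (dual_space W)" by blast
  qed
qed

end

context
  fixes V :: "(complex, 'a) module" and W :: "(complex, 'b) module" and f :: "'a \<Rightarrow> 'b"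
  assumes f: "linear_map complex_field V W f"
begin

interpretation linear_map complex_field V W f by (rule f)

text \<open>A functional of the form \<open>h \<circ> f\<close> kills the kernel of
  \<open>f\<close>. If every functional has this form, the kernel is zero, since functionals
  separate points.\<close>

lemma inj_if_transpose_map_surj:
  assumes fd: "V.fin_dim"
    and surj: "transpose_map V f ` carrier (dual_space W) = carrier (dual_space V)"
  shows "inj_on f (carrier V)"
proof (rule Ke0_imp_inj)
  have "x = \<zero>\<^bsub>V\<^esub>" if x: "x \<in> carrier V" "f x = \<zero>\<^bsub>W\<^esub>" for x
  proof (rule ccontr)
    assume "x \<noteq> \<zero>\<^bsub>V\<^esub>"
    then obtain g where g: "g \<in> carrier (dual_space V)" "g x \<noteq> 0"
      using functional_nonzero_exists[OF V.vectorspace_axioms fd x(1)] by blast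
    then obtain h where h: "h \<in> carrier (dual_space W)" "g = transpose_map V f h"
      using surj by blast
    then have "h \<zero>\<^bsub>W\<^esub> \<noteq> 0" using g(2) x by (simp add: transpose_map_def)
    moreover have "h \<zero>\<^bsub>W\<^esub> = 0"
      by (rule functional_zero[OF W.vectorspace_axioms h(1)])
    ultimately show False by simp
  qed
  then show "carrier (V\<lparr>carrier := ker\<rparr>) = {\<zero>\<^bsub>V\<^esub>}" by (auto simp: ker_def)
qed

text \<open>A vector outside the image gives a nonzero functional on the cokernel; its pullback to
  the codomain is a nonzero functional that the transpose annihilates.\<close>

lemma surj_if_transpose_map_inj:
  assumes fd: "W.fin_dim"
    and inj: "inj_on (transpose_map V f) (carrier (dual_space W))"
  shows "f ` carrier V = carrier W"
proof (rule ccontr)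
  let ?Q = "quotient_space W im" and ?\<pi> = "\<lambda>w. im +>\<^bsub>W\<^esub> w"
  note vs = W.vectorspace_axioms and sub = imT_is_subspace
  note \<pi> = coset_linear_map[OF vs sub]
  assume "f ` carrier V \<noteq> carrier W"
  then obtain w where w: "w \<in> carrier W" "w \<notin> im"
    using f_im by (auto simp: im_def)
  have coset_eq: "?\<pi> v = \<zero>\<^bsub>?Q\<^esub> \<longleftrightarrow> v \<in> im" if "v \<in> carrier W" for v
    using coset_eq_self_iff[OF vs sub that] by (simp add: quotient_space_def)
  have "vectorspace complex_field ?Q" "vectorspace.fin_dim complex_field ?Q"
    by (rule quotient_space_vectorspace[OF vs sub] quotient_space_fin_dim[OF vs sub fd])+
  then obtain g where g: "g \<in> carrier (dual_space ?Q)" "g (?\<pi> w) \<noteq> 0"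
    using functional_nonzero_exists[of ?Q "?\<pi> w"] w coset_eq
    by (auto simp: quotient_space_simps(1)[OF vs sub])
  let ?h = "transpose_map W ?\<pi> g"
  have h: "?h \<in> carrier (dual_space W)" by (rule transpose_map_closed[OF \<pi> g(1)])
  have g0: "g \<zero>\<^bsub>?Q\<^esub> = 0"
    by (rule functional_zero[OF quotient_space_vectorspace[OF vs sub] g(1)])
  interpret D: linear_map complex_field "dual_space W" "dual_space V" "transpose_map V f"
    by (rule transpose_map_linear[OF f])
  have "g (?\<pi> (f v)) = 0" if "v \<in> carrier V" for v
  proof -
    have "?\<pi> (f v) = \<zero>\<^bsub>?Q\<^esub>" using coset_eq[OF f_im] that by (simp add: im_def)
    then show ?thesis using g0 by simp
  qed
  then have "transpose_map V f ?h = \<zero>\<^bsub>dual_space V\<^esub>"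
    by (auto simp: transpose_map_def dual_space_simps intro!: restrict_ext)
  moreover have "\<zero>\<^bsub>dual_space W\<^esub> \<in> carrier (dual_space W)"
    using W.module.smult_closed[simplified] by (simp add: dual_space_simps)
  ultimately have "?h = \<zero>\<^bsub>dual_space W\<^esub>"
    using inj_onD[OF inj _ h] D.f0_is_0 by simp
  then have "?h w = 0" using w(1) by (simp add: dual_space_simps)
  then show False using g(2) w(1) by (simp add: transpose_map_def)
qed

lemma bij_betw_transpose_map_iff:
  assumes "V.fin_dim" "W.fin_dim"
  shows "bij_betw (transpose_map V f) (carrier (dual_space W)) (carrier (dual_space V)) \<longleftrightarrow>
    bij_betw f (carrier V) (carrier W)"
  using inj_if_transpose_map_surj surj_if_transpose_map_inj assms
    transpose_map_inj[OF f] transpose_map_surj[OF f]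
  unfolding bij_betw_def by metis

end

subsection \<open>Reduction and invertibility\<close>

definition pencil_map :: "('m, 'v) pencil_system \<Rightarrow> complex \<Rightarrow> 'm \<Rightarrow> 'v" where
  "pencil_map S l = (\<lambda>x. (l \<odot>\<^bsub>cod_space S\<^esub> Emap S x) \<oplus>\<^bsub>cod_space S\<^esub> Amap S x)"

text \<open>Fixing \<open>l\<close> is finer than regularity: reduction and duality preserve
  bijectivity for each \<open>l\<close> separately, so one \<open>l\<close> can be carried through
  the whole argument.\<close>

definition invertible_at :: "('m, 'v) pencil_system \<Rightarrow> complex \<Rightarrow> bool" where
  "invertible_at S l \<longleftrightarrow> bij_betw (pencil_map S l) (carrier (dom_space S)) (carrier (cod_space S))"

lemma regular_pencil_iff: "regular_pencil S \<longleftrightarrow> (\<exists>l. invertible_at S l)"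
  by (simp add: regular_pencil_def invertible_at_def pencil_map_def)

lemma reduce_simps [simp]:
  "dom_space (reduce S) = (dom_space S)\<lparr>carrier := reduced_dom S\<rparr>"
  "cod_space (reduce S) = (cod_space S)\<lparr>carrier := reduced_cod S\<rparr>"
  "Emap (reduce S) = Emap S" "Amap (reduce S) = Amap S"
  by (simp_all add: reduce_def)

text \<open>Reduction changes only carriers, so bijectivity before and after it concerns the same
  function on different sets.\<close>

lemma pencil_map_reduce [simp]: "pencil_map (reduce S) = pencil_map S"
  by (simp add: pencil_map_def fun_eq_iff)

lemma iter_reduce_simps:
  "iter_reduce 0 S = S" "iter_reduce (Suc k) S = reduce (iter_reduce k S)"
  by (simp_all add: iter_reduce_def)

section \<open>A single reduction step\<close>

context fin_dim_system
begin

abbreviation (input) "M \<equiv> dom_space S"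
abbreviation (input) "V \<equiv> cod_space S"

interpretation M: vectorspace complex_field M by (rule linear_mapD[OF E_linear])
interpretation V: vectorspace complex_field V by (rule linear_mapD[OF E_linear])

lemmas E_simps = linear_mapD(3-5)[OF E_linear, simplified]
lemmas A_simps = linear_mapD(3-5)[OF A_linear, simplified]
lemmas M_smult = M.smult_closed[simplified] M.smult_l_distr[simplified] M.smult_r_distr[simplified]
  M.smult_assoc1[simplified] M.smult_one[simplified]
lemmas V_smult = V.smult_closed[simplified] V.smult_l_distr[simplified] V.smult_r_distr[simplified]
  V.smult_assoc1[simplified] V.smult_one[simplified]

lemma zero_simps: "Emap S \<zero>\<^bsub>M\<^esub> = \<zero>\<^bsub>V\<^esub>" "Amap S \<zero>\<^bsub>M\<^esub> = \<zero>\<^bsub>V\<^esub>"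
proof -
  interpret E: linear_map complex_field M V "Emap S" by (rule E_linear)
  interpret A: linear_map complex_field M V "Amap S" by (rule A_linear)
  show "Emap S \<zero>\<^bsub>M\<^esub> = \<zero>\<^bsub>V\<^esub>" "Amap S \<zero>\<^bsub>M\<^esub> = \<zero>\<^bsub>V\<^esub>" by (rule E.f0_is_0 A.f0_is_0)+
qed

lemma reduced_cod_subspace: "VectorSpace.subspace complex_field (reduced_cod S) V"
proof -
  interpret E: linear_map complex_field M V "Emap S" by (rule E_linear)
  show ?thesis using E.imT_is_subspace by (simp add: E.im_def reduced_cod_def)
qed

lemmas cod_memD = subspace_memD[OF V.vectorspace_axioms reduced_cod_subspace]

lemma reduced_dom_subspace: "VectorSpace.subspace complex_field (reduced_dom S) M"
  by (rule M.subspaceI)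
    (auto simp: reduced_dom_def A_simps zero_simps M_smult intro: cod_memD)

lemmas dom_memD = subspace_memD[OF M.vectorspace_axioms reduced_dom_subspace]

lemma fin_dim_system_reduce: "fin_dim_system (reduce S)"
proof (rule fin_dim_system.intro)
  have vs: "vectorspace complex_field (M\<lparr>carrier := reduced_dom S\<rparr>)"
    "vectorspace complex_field (V\<lparr>carrier := reduced_cod S\<rparr>)"
    using M.subspace_is_vs[OF reduced_dom_subspace] V.subspace_is_vs[OF reduced_cod_subspace] .
  have dom: "x \<in> carrier M" "Emap S x \<in> reduced_cod S" "Amap S x \<in> reduced_cod S"
    if "x \<in> reduced_dom S" for x
    using that by (auto simp: reduced_dom_def reduced_cod_def)
  show "linear_map complex_field (dom_space (reduce S)) (cod_space (reduce S)) (Emap (reduce S))"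
    by (rule linear_mapI) (simp_all add: vs dom E_simps)
  show "linear_map complex_field (dom_space (reduce S)) (cod_space (reduce S)) (Amap (reduce S))"
    by (rule linear_mapI) (simp_all add: vs dom A_simps)
  show "vectorspace.fin_dim complex_field (dom_space (reduce S))"
    using M.subspace_fin_dim[OF reduced_dom_subspace fin_dim_dom] by simp
  show "vectorspace.fin_dim complex_field (cod_space (reduce S))"
    using V.subspace_fin_dim[OF reduced_cod_subspace fin_dim_cod] by simp
qed

text \<open>This is the well-definedness of the induced map: \<open>A\<close> sends the
  \<open>M'\<close> part of a representative into \<open>V'\<close>, where the coset absorbs
  it.\<close>

lemma induced_A_coset:
  assumes x: "x \<in> carrier M"
  shows "induced_A S (reduced_dom S +>\<^bsub>M\<^esub> x) = reduced_cod S +>\<^bsub>V\<^esub> Amap S x"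
proof
  have dom: "a \<in> carrier M" "Amap S a \<in> reduced_cod S" if "a \<in> reduced_dom S" for a
    using that by (auto simp: reduced_dom_def)
  have cod: "b \<in> carrier V" if "b \<in> reduced_cod S" for b
    using that cod_memD(1) by blast
  show "induced_A S (reduced_dom S +>\<^bsub>M\<^esub> x) \<subseteq> reduced_cod S +>\<^bsub>V\<^esub> Amap S x"
  proof
    fix v assume "v \<in> induced_A S (reduced_dom S +>\<^bsub>M\<^esub> x)"
    then obtain a b where ab: "a \<in> reduced_dom S" "b \<in> reduced_cod S"
        "v = Amap S (a \<oplus>\<^bsub>M\<^esub> x) \<oplus>\<^bsub>V\<^esub> b"
      by (auto simp: induced_A_def set_add_def' a_r_coset_def')
    then have "v = (Amap S a \<oplus>\<^bsub>V\<^esub> b) \<oplus>\<^bsub>V\<^esub> Amap S x"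
      using x by (simp add: A_simps dom cod V.M.a_ac)
    then show "v \<in> reduced_cod S +>\<^bsub>V\<^esub> Amap S x"
      using ab cod_memD(3) dom(2) by (auto simp: a_r_coset_def')
  qed
  show "reduced_cod S +>\<^bsub>V\<^esub> Amap S x \<subseteq> induced_A S (reduced_dom S +>\<^bsub>M\<^esub> x)"
  proof
    fix v assume "v \<in> reduced_cod S +>\<^bsub>V\<^esub> Amap S x"
    then obtain b where b: "b \<in> reduced_cod S" "v = b \<oplus>\<^bsub>V\<^esub> Amap S x"
      by (auto simp: a_r_coset_def')
    then have "v = Amap S (\<zero>\<^bsub>M\<^esub> \<oplus>\<^bsub>M\<^esub> x) \<oplus>\<^bsub>V\<^esub> b"
      using x by (simp add: A_simps cod V.M.a_comm)
    then show "v \<in> induced_A S (reduced_dom S +>\<^bsub>M\<^esub> x)"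
      using b dom_memD(2) by (auto simp: induced_A_def set_add_def' a_r_coset_def')
  qed
qed

text \<open>The induced map is onto iff every coset of \<open>V' = EM\<close> contains some
  \<open>A y\<close>, and that is \<open>V = EM + AM\<close>.\<close>

lemma beta_plus_one_eq_0_iff:
  "beta_plus_one S = 0 \<longleftrightarrow>
    (\<forall>v\<in>carrier V. \<exists>x\<in>carrier M. \<exists>y\<in>carrier M. v = Emap S x \<oplus>\<^bsub>V\<^esub> Amap S y)"
proof -
  note q_dom = quotient_space_simps[OF M.vectorspace_axioms reduced_dom_subspace]
  note q_cod = quotient_space_simps[OF V.vectorspace_axioms reduced_cod_subspace]
  have lin: "linear_map complex_field (quotient_space M (reduced_dom S))
      (quotient_space V (reduced_cod S)) (induced_A S)"
    by (rule linear_mapI)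
      (auto simp: q_dom q_cod induced_A_coset A_simps M_smult
        quotient_space_vectorspace M.vectorspace_axioms V.vectorspace_axioms
        reduced_dom_subspace reduced_cod_subspace)
  have "beta_plus_one S = 0 \<longleftrightarrow> induced_A S ` (\<lambda>x. reduced_dom S +>\<^bsub>M\<^esub> x) ` carrier M
      = (\<lambda>v. reduced_cod S +>\<^bsub>V\<^esub> v) ` carrier V"
    unfolding beta_plus_one_def dim_coker_space_eq_0_iff[OF lin
        quotient_space_fin_dim[OF V.vectorspace_axioms reduced_cod_subspace fin_dim_cod]] q_dom q_cod ..
  also have "induced_A S ` (\<lambda>x. reduced_dom S +>\<^bsub>M\<^esub> x) ` carrier M
      = (\<lambda>y. reduced_cod S +>\<^bsub>V\<^esub> Amap S y) ` carrier M"
    by (simp add: image_image induced_A_coset)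
  also have "\<dots> = (\<lambda>v. reduced_cod S +>\<^bsub>V\<^esub> v) ` carrier V \<longleftrightarrow>
      (\<forall>v\<in>carrier V. \<exists>y\<in>carrier M. reduced_cod S +>\<^bsub>V\<^esub> v = reduced_cod S +>\<^bsub>V\<^esub> Amap S y)"
    using A_simps(1) by (auto simp: image_iff set_eq_iff)
  also have "\<dots> \<longleftrightarrow> (\<forall>v\<in>carrier V. \<exists>x\<in>carrier M. \<exists>y\<in>carrier M. v = Emap S x \<oplus>\<^bsub>V\<^esub> Amap S y)"
  proof -
    have "reduced_cod S +>\<^bsub>V\<^esub> v = reduced_cod S +>\<^bsub>V\<^esub> Amap S y \<longleftrightarrow>
        (\<exists>x\<in>carrier M. v = Emap S x \<oplus>\<^bsub>V\<^esub> Amap S y)" if "v \<in> carrier V" "y \<in> carrier M" for v y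
    proof -
      have "v \<ominus>\<^bsub>V\<^esub> Amap S y = Emap S x \<longleftrightarrow> v = Emap S x \<oplus>\<^bsub>V\<^esub> Amap S y" if "x \<in> carrier M" for x
      proof
        assume "v \<ominus>\<^bsub>V\<^esub> Amap S y = Emap S x"
        then have "Emap S x \<oplus>\<^bsub>V\<^esub> Amap S y = (v \<ominus>\<^bsub>V\<^esub> Amap S y) \<oplus>\<^bsub>V\<^esub> Amap S y" by simp
        then show "v = Emap S x \<oplus>\<^bsub>V\<^esub> Amap S y"
          using \<open>v \<in> carrier V\<close> A_simps(1)[OF \<open>y \<in> carrier M\<close>]
          by (simp add: a_minus_def V.M.a_assoc V.M.l_neg)
      next
        assume "v = Emap S x \<oplus>\<^bsub>V\<^esub> Amap S y"
        then show "v \<ominus>\<^bsub>V\<^esub> Amap S y = Emap S x"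
          using E_simps(1)[OF that] A_simps(1)[OF \<open>y \<in> carrier M\<close>]
          by (simp add: a_minus_def V.M.a_assoc V.M.r_neg)
      qed
      then show ?thesis
        using coset_eq_iff[OF V.vectorspace_axioms reduced_cod_subspace \<open>v \<in> carrier V\<close>
            A_simps(1)[OF \<open>y \<in> carrier M\<close>]]
        by (auto simp: reduced_cod_def image_iff)
    qed
    then show ?thesis by blast
  qed
  finally show ?thesis .
qed

lemma pencil_map_linear: "linear_map complex_field M V (pencil_map S l)"
  by (rule linear_mapI)
    (auto simp: M.vectorspace_axioms V.vectorspace_axioms pencil_map_def E_simps A_simps V_smult
      V.M.a_ac mult.commute simp flip: V.smult_assoc1[simplified])

text \<open>The term \<open>l E x\<close> always lies in \<open>V' = EM\<close>. Modulo
  \<open>V'\<close> the pencil map therefore agrees with \<open>A\<close>, and \<open>M'\<close> is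
  the preimage of \<open>V'\<close> under \<open>A\<close>.\<close>

lemma pencil_map_mem_reduced_cod_iff:
  assumes "x \<in> carrier M"
  shows "pencil_map S l x \<in> reduced_cod S \<longleftrightarrow> x \<in> reduced_dom S"
proof
  have E: "l \<odot>\<^bsub>V\<^esub> Emap S x \<in> reduced_cod S"
    using assms by (intro cod_memD(4)) (simp add: reduced_cod_def)
  then show "pencil_map S l x \<in> reduced_cod S" if "x \<in> reduced_dom S"
    using that cod_memD(3) by (simp add: pencil_map_def reduced_dom_def)
  assume "pencil_map S l x \<in> reduced_cod S"
  \<comment> \<open>Subtracting \<open>l E x\<close> leaves \<open>A x\<close>.\<close>
  then have "\<ominus>\<^bsub>V\<^esub> (l \<odot>\<^bsub>V\<^esub> Emap S x) \<oplus>\<^bsub>V\<^esub> pencil_map S l x \<in> reduced_cod S"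
    using E cod_memD(3) subspace_a_inv_closed[OF V.vectorspace_axioms reduced_cod_subspace] by blast
  then show "x \<in> reduced_dom S"
    using assms by (simp add: pencil_map_def reduced_dom_def V.M.r_neg1 E_simps A_simps V_smult)
qed

text \<open>As \<open>M'\<close> is the full preimage of \<open>V'\<close> under the pencil map, a
  bijection from \<open>M\<close> to \<open>V\<close> restricts to one from \<open>M'\<close> to
  \<open>V'\<close>.\<close>

lemma invertible_at_reduce:
  assumes "invertible_at S l"
  shows "invertible_at (reduce S) l"
proof -
  have bij: "bij_betw (pencil_map S l) (carrier M) (carrier V)"
    using assms by (simp add: invertible_at_def)
  have "bij_betw (pencil_map S l) (reduced_dom S) (reduced_cod S)"
    unfolding bij_betw_def
  proof
    show "inj_on (pencil_map S l) (reduced_dom S)"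
      using bij dom_memD(1) by (auto simp: bij_betw_def intro: inj_on_subset)
    show "pencil_map S l ` reduced_dom S = reduced_cod S"
    proof
      show "pencil_map S l ` reduced_dom S \<subseteq> reduced_cod S"
        using pencil_map_mem_reduced_cod_iff dom_memD(1) by blast
      show "reduced_cod S \<subseteq> pencil_map S l ` reduced_dom S"
      proof
        fix v assume v: "v \<in> reduced_cod S"
        then obtain x where "x \<in> carrier M" "v = pencil_map S l x"
          using bij cod_memD(1) by (auto simp: bij_betw_def)
        then show "v \<in> pencil_map S l ` reduced_dom S"
          using pencil_map_mem_reduced_cod_iff v by blast
      qed
    qed
  qed
  then show ?thesis by (simp add: invertible_at_def)
qed

text \<open>A value \<open>(lE + A) x\<close> is the sum of \<open>E (l x)\<close> and
  \<open>A x\<close>, so surjectivity gives \<open>V = EM + AM\<close>.\<close>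

lemma beta_plus_one_eq_0_if_invertible_at:
  assumes "invertible_at S l"
  shows "beta_plus_one S = 0"
  unfolding beta_plus_one_eq_0_iff
proof
  fix v assume "v \<in> carrier V"
  then obtain x where x: "x \<in> carrier M" "v = pencil_map S l x"
    using assms by (auto simp: invertible_at_def bij_betw_def)
  then have "v = Emap S (l \<odot>\<^bsub>M\<^esub> x) \<oplus>\<^bsub>V\<^esub> Amap S x"
    by (simp add: pencil_map_def E_simps)
  then show "\<exists>x\<in>carrier M. \<exists>y\<in>carrier M. v = Emap S x \<oplus>\<^bsub>V\<^esub> Amap S y"
    using x(1) M_smult(1) by blast
qed

text \<open>The kernel of the pencil map lies in \<open>M'\<close> because zero lies in
  \<open>V'\<close>, so injectivity on \<open>M'\<close> suffices. Surjectivity corrects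
  \<open>lE + A\<close> at \<open>y\<close> by an element of \<open>V'\<close>, which already has a
  preimage in \<open>M'\<close>.\<close>

lemma invertible_at_if_reduce:
  assumes red: "invertible_at (reduce S) l" and beta: "beta_plus_one S = 0"
  shows "invertible_at S l"
proof -
  interpret P: linear_map complex_field M V "pencil_map S l" by (rule pencil_map_linear)
  have bij: "bij_betw (pencil_map S l) (reduced_dom S) (reduced_cod S)"
    using red by (simp add: invertible_at_def)
  have "inj_on (pencil_map S l) (carrier M)"
  proof (rule P.Ke0_imp_inj)
    have "x = \<zero>\<^bsub>M\<^esub>" if x: "x \<in> carrier M" "pencil_map S l x = \<zero>\<^bsub>V\<^esub>" for x
    proof -
      have "x \<in> reduced_dom S"
        using pencil_map_mem_reduced_cod_iff[OF x(1), of l] x(2) cod_memD(2) by simp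
      moreover have "pencil_map S l x = pencil_map S l \<zero>\<^bsub>M\<^esub>" using x(2) by simp
      ultimately show ?thesis
        using bij dom_memD(2) unfolding bij_betw_def by (meson inj_onD)
    qed
    then show "carrier (M\<lparr>carrier := P.ker\<rparr>) = {\<zero>\<^bsub>M\<^esub>}" by (auto simp: P.ker_def)
  qed
  moreover have "pencil_map S l ` carrier M = carrier V"
  proof
    show "pencil_map S l ` carrier M \<subseteq> carrier V" using P.f_im by blast
    show "carrier V \<subseteq> pencil_map S l ` carrier M"
    proof
      fix v assume v: "v \<in> carrier V"
      then obtain x y where xy: "x \<in> carrier M" "y \<in> carrier M" "v = Emap S x \<oplus>\<^bsub>V\<^esub> Amap S y"
        using beta by (auto simp: beta_plus_one_eq_0_iff)
      \<comment> \<open>This is \<open>E (x - l y)\<close>, the difference between \<open>v\<close>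
        and \<open>(lE + A) y\<close>.\<close>
      define w where "w = Emap S x \<oplus>\<^bsub>V\<^esub> \<ominus>\<^bsub>V\<^esub> (l \<odot>\<^bsub>V\<^esub> Emap S y)"
      have "w \<in> reduced_cod S"
        unfolding w_def using xy
        by (intro cod_memD(3,4) subspace_a_inv_closed[OF V.vectorspace_axioms reduced_cod_subspace])
          (auto simp: reduced_cod_def)
      then obtain z where z: "z \<in> reduced_dom S" "w = pencil_map S l z"
        using bij by (auto simp: bij_betw_def)
      have "v = w \<oplus>\<^bsub>V\<^esub> pencil_map S l y"
        using xy by (simp add: w_def pencil_map_def V.M.a_assoc V.M.r_neg1 E_simps A_simps V_smult)
      also have "\<dots> = pencil_map S l (z \<oplus>\<^bsub>M\<^esub> y)"
        using z xy dom_memD(1) by (subst P.f_add) auto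
      finally show "v \<in> pencil_map S l ` carrier M"
        using z xy dom_memD(1) by (metis M.M.a_closed image_eqI subsetD)
    qed
  qed
  ultimately show ?thesis by (simp add: invertible_at_def bij_betw_def)
qed

end

section \<open>Termination of the reduction and the limit system\<close>

lemma reduce_eq_iff:
  "reduce S = S \<longleftrightarrow> reduced_dom S = carrier (dom_space S) \<and> reduced_cod S = carrier (cod_space S)"
proof
  assume "reduce S = S"
  then have "carrier (dom_space (reduce S)) = carrier (dom_space S)"
    "carrier (cod_space (reduce S)) = carrier (cod_space S)" by simp_all
  then show "reduced_dom S = carrier (dom_space S) \<and> reduced_cod S = carrier (cod_space S)" by simp
qed (simp add: reduce_def)

text \<open>Provides the termination measure: if the system changes, at least one of the two
  subspaces is proper, and neither dimension can grow.\<close>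

lemma (in fin_dim_system) dim_reduce_less:
  assumes "reduce S \<noteq> S"
  shows "cdim (dom_space (reduce S)) + cdim (cod_space (reduce S))
    < cdim (dom_space S) + cdim (cod_space S)"
proof -
  interpret M: vectorspace complex_field "dom_space S" by (rule linear_mapD[OF E_linear])
  interpret V: vectorspace complex_field "cod_space S" by (rule linear_mapD[OF E_linear])
  have "reduced_dom S \<noteq> carrier (dom_space S) \<or> reduced_cod S \<noteq> carrier (cod_space S)"
    using assms by (simp add: reduce_eq_iff)
  then show ?thesis
    using M.dim_subspace_le[OF reduced_dom_subspace fin_dim_dom]
      M.dim_subspace_less[OF reduced_dom_subspace fin_dim_dom]
      V.dim_subspace_le[OF reduced_cod_subspace fin_dim_cod]
      V.dim_subspace_less[OF reduced_cod_subspace fin_dim_cod]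
    by (elim disjE) (simp_all add: add_less_le_mono add_le_less_mono)
qed

lemma fin_dim_system_iter_reduce:
  "fin_dim_system S \<Longrightarrow> fin_dim_system (iter_reduce k S)"
  by (induction k) (simp_all add: iter_reduce_simps fin_dim_system.fin_dim_system_reduce)

text \<open>The dimension sum cannot drop forever, so some index satisfies the condition under
  \<open>LEAST\<close> in \<open>system_index\<close>, and hence the least one does too.\<close>

lemma reduce_reduce_limit:
  assumes "fin_dim_system S"
  shows "reduce (reduce_limit S) = reduce_limit S"
proof -
  let ?d = "\<lambda>k. cdim (dom_space (iter_reduce k S)) + cdim (cod_space (iter_reduce k S))"
  have "\<exists>n. iter_reduce (Suc n) S = iter_reduce n S"
  proof (rule ccontr)
    assume "\<nexists>n. iter_reduce (Suc n) S = iter_reduce n S"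
    then have less: "?d (Suc k) < ?d k" for k
      using fin_dim_system.dim_reduce_less[OF fin_dim_system_iter_reduce[OF assms, of k]]
      by (simp add: iter_reduce_simps)
    \<comment> \<open>Each step costs at least one dimension, so \<open>Suc (?d 0)\<close> steps are
      impossible.\<close>
    have "?d k + k \<le> ?d 0" for k
    proof (induction k)
      case (Suc k)
      then show ?case using less[of k] by linarith
    qed simp
    from this[of "Suc (?d 0)"] show False by simp
  qed
  from LeastI_ex[OF this] show ?thesis
    by (simp add: reduce_limit_def system_index_def iter_reduce_simps)
qed

lemma fin_dim_system_reduce_limit: "fin_dim_system S \<Longrightarrow> fin_dim_system (reduce_limit S)"
  by (simp add: reduce_limit_def fin_dim_system_iter_reduce)

text \<open>A system fixed by reduction has \<open>EM = V' = V\<close>.\<close>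

lemma Emap_reduce_limit_surj:
  assumes "fin_dim_system S"
  shows "Emap (reduce_limit S) ` carrier (dom_space (reduce_limit S))
    = carrier (cod_space (reduce_limit S))"
  using reduce_reduce_limit[OF assms] by (simp add: reduce_eq_iff reduced_cod_def)

text \<open>Reduction keeps the function \<open>E\<close> and only shrinks its domain.\<close>

lemma Emap_reduce_limit_inj:
  assumes "inj_on (Emap S) (carrier (dom_space S))"
  shows "inj_on (Emap (reduce_limit S)) (carrier (dom_space (reduce_limit S)))"
proof -
  have "Emap (iter_reduce k S) = Emap S \<and>
      carrier (dom_space (iter_reduce k S)) \<subseteq> carrier (dom_space S)" for k
    by (induction k) (auto simp: iter_reduce_simps reduced_dom_def)
  then show ?thesis
    using assms inj_on_subset unfolding reduce_limit_def by metis
qed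

text \<open>Iterates the equivalence for a single step. The number \<open>k\<close> is arbitrary, so
  defects beyond the index are reached as well.\<close>

lemma invertible_at_iter_reduce:
  assumes "fin_dim_system S"
  shows "invertible_at S l \<longleftrightarrow>
    (\<forall>i<k. beta_plus_one (iter_reduce i S) = 0) \<and> invertible_at (iter_reduce k S) l"
proof (induction k)
  case (Suc k)
  interpret T: fin_dim_system "iter_reduce k S" by (rule fin_dim_system_iter_reduce[OF assms])
  have "invertible_at (iter_reduce k S) l \<longleftrightarrow> beta_plus_one (iter_reduce k S) = 0
      \<and> invertible_at (iter_reduce (Suc k) S) l"
    using T.invertible_at_reduce T.invertible_at_if_reduce T.beta_plus_one_eq_0_if_invertible_at
    unfolding iter_reduce_simps by blast
  then show ?case using Suc.IH by (auto simp: less_Suc_eq)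
qed (simp add: iter_reduce_simps)

lemma invertible_at_iff_reduce_limit:
  assumes "fin_dim_system S"
  shows "invertible_at S l \<longleftrightarrow> (\<forall>k\<ge>1. beta_plus k S = 0) \<and> invertible_at (reduce_limit S) l"
proof
  assume inv: "invertible_at S l"
  have "beta_plus_one (iter_reduce k S) = 0" for k
    using inv invertible_at_iter_reduce[OF assms, of l "Suc k"] by blast
  then show "(\<forall>k\<ge>1. beta_plus k S = 0) \<and> invertible_at (reduce_limit S) l"
    using inv invertible_at_iter_reduce[OF assms] by (auto simp: beta_plus_def reduce_limit_def)
next
  assume *: "(\<forall>k\<ge>1. beta_plus k S = 0) \<and> invertible_at (reduce_limit S) l"
  \<comment> \<open>Defects are counted from 1: \<open>beta_plus (Suc k)\<close> belongs to the
    \<open>k\<close>-fold reduction.\<close>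
  have "beta_plus_one (iter_reduce k S) = 0" for k
    using *[THEN conjunct1, rule_format, of "Suc k"] by (simp add: beta_plus_def)
  then show "invertible_at S l"
    using * invertible_at_iter_reduce[OF assms] by (auto simp: reduce_limit_def)
qed

subsection \<open>The dual system\<close>

lemma dual_system_simps [simp]:
  "dom_space (dual_system S) = dual_space (cod_space S)"
  "cod_space (dual_system S) = dual_space (dom_space S)"
  "Emap (dual_system S) = transpose_map (dom_space S) (Emap S)"
  "Amap (dual_system S) = transpose_map (dom_space S) (Amap S)"
  by (simp_all add: dual_system_def)

context fin_dim_system
begin

lemma fin_dim_system_dual: "fin_dim_system (dual_system S)"
  by (rule fin_dim_system.intro)
    (simp_all add: transpose_map_linear E_linear A_linear dual_space_fin_dim
      linear_mapD(1,2)[OF E_linear] fin_dim_dom fin_dim_cod)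

text \<open>Linearity of \<open>g\<close> moves the scalar and the sum across, so the two maps are
  compared on functionals only.\<close>

lemma pencil_map_dual:
  assumes g: "g \<in> carrier (dual_space (cod_space S))"
  shows "pencil_map (dual_system S) l g = transpose_map (dom_space S) (pencil_map S l) g"
proof -
  interpret V: vectorspace complex_field "cod_space S" by (rule linear_mapD[OF E_linear])
  show ?thesis
    using g
    by (auto simp: pencil_map_def dual_space_simps transpose_map_def E_simps A_simps
        V.smult_closed[simplified] intro!: restrict_ext)
qed

lemma invertible_at_dual_iff: "invertible_at (dual_system S) l \<longleftrightarrow> invertible_at S l"
proof -
  have "invertible_at (dual_system S) l \<longleftrightarrow>
      bij_betw (transpose_map (dom_space S) (pencil_map S l))
        (carrier (dual_space (cod_space S))) (carrier (dual_space (dom_space S)))"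
    unfolding invertible_at_def dual_system_simps by (intro bij_betw_cong pencil_map_dual)
  also have "\<dots> \<longleftrightarrow> invertible_at S l"
    unfolding invertible_at_def
    by (rule bij_betw_transpose_map_iff[OF pencil_map_linear fin_dim_dom fin_dim_cod])
  finally show ?thesis .
qed

text \<open>Composing with the inverse of \<open>E\<close> turns \<open>lE + A\<close> into a shift
  by \<open>l\<close> of an endomorphism of \<open>M\<close>. Some natural number \<open>l\<close>
  makes its kernel trivial, and since \<open>M\<close> and \<open>V\<close> have equal dimension,
  injectivity gives bijectivity.\<close>

lemma invertible_at_exists_if_Emap_bij:
  assumes bij: "bij_betw (Emap S) (carrier (dom_space S)) (carrier (cod_space S))"
  shows "\<exists>l. invertible_at S l"
proof -
  interpret M: vectorspace complex_field "dom_space S" by (rule linear_mapD[OF E_linear])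
  interpret V: vectorspace complex_field "cod_space S" by (rule linear_mapD[OF E_linear])
  let ?inv = "inv_into (carrier (dom_space S)) (Emap S)"
  note inv = linear_map_inv_into[OF E_linear bij]
  note inv_simps = linear_mapD(3-5)[OF inv, simplified]
  have inv_E: "?inv (Emap S x) = x" if "x \<in> carrier (dom_space S)" for x
    using bij that by (simp add: bij_betw_def)
  obtain k :: nat where k: "x = \<zero>\<^bsub>dom_space S\<^esub>"
    if "x \<in> carrier (dom_space S)"
      "of_nat k \<odot>\<^bsub>dom_space S\<^esub> x \<oplus>\<^bsub>dom_space S\<^esub> ?inv (Amap S x) = \<zero>\<^bsub>dom_space S\<^esub>" for x
    using exists_shift_kernel_trivial[OF linear_map_comp[OF A_linear inv] fin_dim_dom] by blast
  interpret P: linear_map complex_field "dom_space S" "cod_space S" "pencil_map S (of_nat k)"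
    by (rule pencil_map_linear)
  interpret inv: linear_map complex_field "cod_space S" "dom_space S" ?inv by (rule inv)
  have inj: "inj_on (pencil_map S (of_nat k)) (carrier (dom_space S))"
  proof (rule P.Ke0_imp_inj)
    have "x = \<zero>\<^bsub>dom_space S\<^esub>"
      if x: "x \<in> carrier (dom_space S)" "pencil_map S (of_nat k) x = \<zero>\<^bsub>cod_space S\<^esub>" for x
    proof (rule k[OF x(1)])
      have "of_nat k \<odot>\<^bsub>dom_space S\<^esub> x \<oplus>\<^bsub>dom_space S\<^esub> ?inv (Amap S x)
          = ?inv (pencil_map S (of_nat k) x)"
        using x(1) by (simp add: pencil_map_def inv_simps inv_E E_simps A_simps V_smult)
      then show "of_nat k \<odot>\<^bsub>dom_space S\<^esub> x \<oplus>\<^bsub>dom_space S\<^esub> ?inv (Amap S x) = \<zero>\<^bsub>dom_space S\<^esub>"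
        using x(2) inv.f0_is_0 by simp
    qed
    then show "carrier ((dom_space S)\<lparr>carrier := P.ker\<rparr>) = {\<zero>\<^bsub>dom_space S\<^esub>}"
      by (auto simp: P.ker_def)
  qed
  have "pencil_map S (of_nat k) ` carrier (dom_space S) = carrier (cod_space S)"
  proof (rule ccontr)
    interpret E: linear_map complex_field "dom_space S" "cod_space S" "Emap S" by (rule E_linear)
    assume "pencil_map S (of_nat k) ` carrier (dom_space S) \<noteq> carrier (cod_space S)"
    then have "cdim ((cod_space S)\<lparr>carrier := P.im\<rparr>) < cdim (cod_space S)"
      by (intro V.dim_subspace_less P.imT_is_subspace fin_dim_cod) (simp add: P.im_def)
    moreover have "cdim (dom_space S) = cdim (cod_space S)"
      using bij E.dim_eq[OF fin_dim_dom] by (simp add: bij_betw_def)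
    ultimately show False
      using P.rank_nullity[OF fin_dim_dom] P.inj_imp_dim_ker0[OF inj] by simp
  qed
  then show ?thesis using inj by (auto simp: invertible_at_def bij_betw_def)
qed

end

theorem proposition3p20:
  fixes S :: "('m, 'v) pencil_system"
  assumes "fin_dim_system S"
  shows "regular_pencil S \<longleftrightarrow> (\<forall>k\<ge>1. beta_plus k S = 0 \<and> beta_minus k S = 0)"
proof -
  define T where "T = reduce_limit S"
  define D where "D = dual_system T"
  interpret T: fin_dim_system T
    unfolding T_def by (rule fin_dim_system_reduce_limit[OF assms])
  have D: "fin_dim_system D" unfolding D_def by (rule T.fin_dim_system_dual)
  have inv_S: "invertible_at S l \<longleftrightarrow> (\<forall>k\<ge>1. beta_plus k S = 0) \<and> invertible_at T l" for l
    unfolding T_def by (rule invertible_at_iff_reduce_limit[OF assms])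
  \<comment> \<open>By duality \<open>l\<close> may be tested on \<open>D\<close>, whose
    \<open>beta_plus\<close> values are the \<open>beta_minus\<close> values of
    \<open>S\<close>.\<close>
  have inv_T: "invertible_at T l \<longleftrightarrow> (\<forall>k\<ge>1. beta_minus k S = 0) \<and> invertible_at (reduce_limit D) l" for l
    using invertible_at_iff_reduce_limit[OF D] T.invertible_at_dual_iff
    by (simp add: beta_minus_def D_def T_def)
  \<comment> \<open>In the limit \<open>T\<close> the map \<open>E\<close> is onto, so its transpose
    is injective.\<close>
  have "inj_on (Emap D) (carrier (dom_space D))"
    using transpose_map_inj[OF T.E_linear] Emap_reduce_limit_surj[OF assms]
    by (simp add: D_def T_def)
  then have "bij_betw (Emap (reduce_limit D)) (carrier (dom_space (reduce_limit D)))
      (carrier (cod_space (reduce_limit D)))"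
    using Emap_reduce_limit_inj Emap_reduce_limit_surj[OF D] by (simp add: bij_betw_def)
  then have "\<exists>l. invertible_at (reduce_limit D) l"
    by (rule fin_dim_system.invertible_at_exists_if_Emap_bij[OF fin_dim_system_reduce_limit[OF D]])
  \<comment> \<open>The defect conditions do not involve \<open>l\<close>, so they come out of the
    existential quantifier; what remains inside has just been established.\<close>
  then show ?thesis
    unfolding regular_pencil_iff inv_S inv_T by blast
qed

end
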